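(* Assume that there are constants $\delta_{\mathrm{int}}\ge0$, $C_{\mathrm{proj}}^{\mathrm{app}},C_{\mathrm{harm}}^{\mathrm{app}}<\infty$, $\Delta_{\mathrm{proj},N},\Delta_{\mathrm{harm},M}\ge0$ such that for every intrinsic package $\mathcal D$ there is $\zeta_{\mathrm{int}}=\zeta_{\mathrm{int}}(\mathcal D)\in\Gamma_\Lambda^{\mathrm{int}}$ with $$\|\mathcal D-\zeta_{\mathrm{int}}\|_{\mathrm{loc,int}}\le\operatorname{dist}_{\mathrm{loc,int}}(\mathcal D,\Gamma_\Lambda^{\mathrm{int}})+\delta_{\mathrm{int}},$$ $$\mathcal T_{\mathrm{proj}}(\mathcal D;\zeta_{\mathrm{int}})\le C_{\mathrm{proj}}^{\mathrm{app}}\operatorname{dist}_{\mathrm{loc,int}}(\mathcal D,\Gamma_\Lambda^{\mathrm{int}})+\Delta_{\mathrm{proj},N},$$ $$\mathcal T_{\mathrm{harm}}(\mathcal D;\zeta_{\mathrm{int}})\le C_{\mathrm{harm}}^{\mathrm{app}}\operatorname{dist}_{\mathrm{loc,int}}(\mathcal D,\Gamma_\Lambda^{\mathrm{int}})+\Delta_{\mathrm{harm},M}.$$ Then for every intrinsic package $\mathcal D$, $$\operatorname{dist}_{\mathrm{loc,int}}^{\sharp,\mathrm{tail}}(\mathcal D,\Gamma_\Lambda^{\mathrm{int}})\le\big(1+\alpha_{\mathrm{proj}}C_{\mathrm{proj}}^{\mathrm{app}}+\alpha_{\mathrm{harm}}C_{\mathrm{harm}}^{\mathrm{app}}\big)\operatorname{dist}_{\mathrm{loc,int}}(\mathcal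 D,\Gamma_\Lambda^{\mathrm{int}})+\delta_{\mathrm{int}}+\alpha_{\mathrm{proj}}\Delta_{\mathrm{proj},N}+\alpha_{\mathrm{harm}}\Delta_{\mathrm{harm},M}.$$
   Context: Intrinsic packages. $\Lambda$ is a finite set of consecutive integers. For $k\in\Lambda$, $j=1,\dots,7$, let $X_k^{(j)}$ be normed spaces; an intrinsic package is $\mathcal D=(x_k^{(j)})_{k,j}$, $x_k^{(j)}\in X_k^{(j)}$, with norm $\|\mathcal D\|_{\mathrm{loc,int}}^2=\sum_{k}\sum_{j}a_j\|x_k^{(j)}\|^2$, $a_j>0$ fixed; $\Gamma_\Lambda^{\mathrm{int}}$ is a linear subspace of the space of intrinsic packages and $\operatorname{dist}_{\mathrm{loc,int}}(\mathcal D,\Gamma_\Lambda^{\mathrm{int}})=\inf_{\zeta\in\Gamma_\Lambda^{\mathrm{int}}}\|\mathcal D-\zeta\|_{\mathrm{loc,int}}$. Enhanced-tail distance. Let $B_r\subset\mathbb R^3$ be the ball of radius $r$ about $0$, $I=(-1,0)$, $Y_{\mathrm{prs}}=L^{3/2}(I;L^{3/2}(B_{1/2}))$, and $\mathsf R_i$ the Riesz transforms on $\mathbb R^3$ (tensors on $B_1$ are extended by zero, repeated indices summed, results restricted to $B_{1/2}$). Each package $\mathcal D$ carries a clean source tensor $F^{\mathrm{cl}}_{ij}(\mathcal D)=U_iU_j+R_{ij}\in L^{3/2}(I;L^{3/2}(B_1))$ built from its clean velocity and covariance coordinates $U,R$, and a harmonic pressure component $p_{\mathrm{harm}}(\mathcal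 D)$ in a normed space $Y_{\mathrm{harm}}$. $P_{\mathrm{prs},N}^{\mathrm{cl}}$ is a bounded linear projection on $Y_{\mathrm{prs}}$, $\Pi_{\mathrm{harm},M}$ a bounded projection of $Y_{\mathrm{harm}}$ onto a finite-dimensional subspace, $J_{\mathrm{harm}}:Y_{\mathrm{harm}}\to Y_{\mathrm{prs}}$ bounded linear. For $\zeta\in\Gamma_\Lambda^{\mathrm{int}}$, $\mathcal T_{\mathrm{proj}}(\mathcal D;\zeta)=(1+\|P_{\mathrm{prs},N}^{\mathrm{cl}}\|)\|\mathsf R_i\mathsf R_jF_{ij}^{\mathrm{cl}}(\mathcal D-\zeta)\|_{Y_{\mathrm{prs}}}$, $\mathcal T_{\mathrm{harm}}(\mathcal D;\zeta)=\|J_{\mathrm{harm}}\|\,\|(I-\Pi_{\mathrm{harm},M})p_{\mathrm{harm}}(\mathcal D-\zeta)\|_{Y_{\mathrm{harm}}}$. For fixed $\alpha_{\mathrm{proj}},\alpha_{\mathrm{harm}}>0$, $$\operatorname{dist}_{\mathrm{loc,int}}^{\sharp,\mathrm{tail}}(\mathcal D,\Gamma_\Lambda^{\mathrm{int}})=\inf_{\zeta\in\Gamma_\Lambda^{\mathrm{int}}}\big(\|\mathcal D-\zeta\|_{\mathrm{loc,int}}+\alpha_{\mathrm{proj}}\mathcal T_{\mathrm{proj}}(\mathcal D;\zeta)+\alpha_{\mathrm{harm}}\mathcal T_{\mathrm{harm}}(\mathcal D;\zeta)\big).$$ *)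

theory Defs
  imports "HOL-Analysis.Analysis" "HOL-Library.Function_Algebras"
begin

section \<open>Pointwise linear structure on functions\<close>

instantiation "fun" :: (type, real_vector) real_vector
begin

definition scaleR_fun :: "real \<Rightarrow> ('a \<Rightarrow> 'b) \<Rightarrow> 'a \<Rightarrow> 'b"
  where "scaleR_fun c f = (\<lambda>x. c *\<^sub>R f x)"

instance
  by standard (auto simp: scaleR_fun_def fun_eq_iff algebra_simps)

end

section \<open>The spaces $L^{3/2}(I;L^{3/2}(B_r))$\<close>

definition Lp_norm :: "real \<Rightarrow> 'a measure \<Rightarrow> ('a \<Rightarrow> real) \<Rightarrow> real"
  where "Lp_norm p M f = (\<integral>x. \<bar>f x\<bar> powr p \<partial>M) powr (1 / p)"

abbreviation time_measure :: "real measure"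
  where "time_measure \<equiv> restrict_space lborel {-1<..<0}"

abbreviation ball_measure :: "real \<Rightarrow> (real ^ 3) measure"
  where "ball_measure r \<equiv> restrict_space lborel (ball 0 r)"

text \<open>Elements of $L^{3/2}(I;L^{3/2}(B_r))$ are represented by jointly Borel measurable functions
  \<open>f t x\<close>, of which only the values with \<open>t \<in> I\<close> and \<open>x \<in> B\<^sub>r\<close> matter.\<close>

definition L32_L32 :: "real \<Rightarrow> (real \<Rightarrow> real ^ 3 \<Rightarrow> real) set"
  where "L32_L32 r = {f.
    case_prod f \<in> borel_measurable (time_measure \<Otimes>\<^sub>M ball_measure r) \<and>
    (\<integral>\<^sup>+t. \<integral>\<^sup>+x. ennreal (\<bar>f t x\<bar> powr (3/2)) \<partial>ball_measure r \<partial>time_measure) < \<infinity>}"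

definition L32_L32_norm :: "real \<Rightarrow> (real \<Rightarrow> real ^ 3 \<Rightarrow> real) \<Rightarrow> real"
  where "L32_L32_norm r f = Lp_norm (3/2) time_measure (\<lambda>t. Lp_norm (3/2) (ball_measure r) (f t))"

abbreviation cyl_measure :: "real \<Rightarrow> (real \<times> (real ^ 3)) measure"
  where "cyl_measure r \<equiv> time_measure \<Otimes>\<^sub>M ball_measure r"

lemma sigma_finite_time: "sigma_finite_measure time_measure"
  by (rule sigma_finite_measure_restrict_space) (auto intro: lborel.sigma_finite_measure_axioms)

lemma sigma_finite_ball: "sigma_finite_measure (ball_measure r)"
  by (rule sigma_finite_measure_restrict_space) (auto intro: lborel.sigma_finite_measure_axioms)

lemma pair_sigma_finite_cyl: "pair_sigma_finite time_measure (ball_measure r)"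
  by (simp add: pair_sigma_finite_def sigma_finite_time sigma_finite_ball)

lemma L32_L32_iff:
  "f \<in> L32_L32 r \<longleftrightarrow> case_prod f \<in> borel_measurable (cyl_measure r) \<and>
     integrable (cyl_measure r) (\<lambda>z. \<bar>case_prod f z\<bar> powr (3/2))"
proof -
  interpret pair_sigma_finite time_measure "ball_measure r" by (rule pair_sigma_finite_cyl)
  have "(\<integral>\<^sup>+t. \<integral>\<^sup>+x. ennreal (\<bar>f t x\<bar> powr (3/2)) \<partial>ball_measure r \<partial>time_measure)
      = (\<integral>\<^sup>+z. ennreal (\<bar>case_prod f z\<bar> powr (3/2)) \<partial>cyl_measure r)"
    if "case_prod f \<in> borel_measurable (cyl_measure r)"
    by (subst M2.nn_integral_fst[symmetric]) (use that in \<open>auto\<close>)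
  then show ?thesis
    by (auto simp: L32_L32_def integrable_iff_bounded)
qed

lemma L32_L32_norm_eq:
  assumes "f \<in> L32_L32 r"
  shows "L32_L32_norm r f = Lp_norm (3/2) (cyl_measure r) (case_prod f)"
proof -
  interpret pair_sigma_finite time_measure "ball_measure r" by (rule pair_sigma_finite_cyl)
  have "integrable (cyl_measure r) (\<lambda>z. \<bar>case_prod f z\<bar> powr (3/2))"
    using assms by (simp add: L32_L32_iff)
  from integral_fst'[OF this]
  have "(\<integral>t. (\<integral>x. \<bar>f t x\<bar> powr (3/2) \<partial>ball_measure r) \<partial>time_measure)
      = (\<integral>z. \<bar>case_prod f z\<bar> powr (3/2) \<partial>cyl_measure r)"
    by simp
  then show ?thesis
    by (simp add: L32_L32_norm_def Lp_norm_def powr_powr)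
qed

lemma powr_convex_comb:
  fixes p l x y :: real
  assumes "p \<ge> 1" "0 \<le> l" "l \<le> 1" "0 \<le> x" "0 \<le> y"
  shows "(l * x + (1 - l) * y) powr p \<le> l * x powr p + (1 - l) * y powr p"
proof -
  have sc: "(c * z) powr p \<le> c * z powr p" if "0 \<le> c" "c \<le> 1" "0 \<le> z" for c z :: real
  proof (cases "c = 0")
    case False
    then have "c powr p \<le> c powr 1"
      using that assms by (intro powr_mono') auto
    then show ?thesis
      using that by (auto simp: powr_mult intro: mult_right_mono)
  qed simp
  consider "x = 0" | "y = 0" | "x > 0" "y > 0" using assms by fastforce
  then show ?thesis
  proof cases
    case 1 then show ?thesis using sc[of "1 - l" y] assms by simp
  next
    case 2 then show ?thesis using sc[of l x] assms by simp
  next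
    case 3
    then show ?thesis
      using convex_onD[OF powr_convex[OF assms(1)], of "1 - l" x y] assms by (simp add: algebra_simps)
  qed
qed

lemma Lp_norm_nonneg: "0 \<le> Lp_norm p M f"
  by (simp add: Lp_norm_def)

lemma Lp_norm_powr:
  assumes "p > 0" shows "(Lp_norm p M f) powr p = (\<integral>x. \<bar>f x\<bar> powr p \<partial>M)"
  using assms by (simp add: Lp_norm_def powr_powr Bochner_Integration.integral_nonneg)

lemma Minkowski_aux:
  assumes p: "p \<ge> 1"
    and f: "f \<in> borel_measurable M" "integrable M (\<lambda>x. \<bar>f x\<bar> powr p)"
    and g: "g \<in> borel_measurable M" "integrable M (\<lambda>x. \<bar>g x\<bar> powr p)"
    and A: "Lp_norm p M f < A" and B: "Lp_norm p M g < B"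
  shows "integrable M (\<lambda>x. \<bar>f x + g x\<bar> powr p)" "Lp_norm p M (\<lambda>x. f x + g x) \<le> A + B"
proof -
  have A0: "A > 0" and B0: "B > 0"
    using A B Lp_norm_nonneg[of p M f] Lp_norm_nonneg[of p M g] by linarith+
  define l where "l = A / (A + B)"
  have l: "0 \<le> l" "l \<le> 1" "1 - l = B / (A + B)" using A0 B0 by (auto simp: l_def field_simps)
  let ?h = "\<lambda>x. (A + B) powr p *
    (l * (\<bar>f x\<bar> powr p / A powr p) + (1 - l) * (\<bar>g x\<bar> powr p / B powr p))"
  have le: "\<bar>f x + g x\<bar> powr p \<le> ?h x" for x
  proof -
    have "\<bar>f x + g x\<bar> \<le> (A + B) * (l * (\<bar>f x\<bar> / A) + (1 - l) * (\<bar>g x\<bar> / B))"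
      using A0 B0 unfolding l(3) by (simp add: l_def distrib_left add_pos_pos)
    then have "\<bar>f x + g x\<bar> powr p \<le> ((A + B) * (l * (\<bar>f x\<bar> / A) + (1 - l) * (\<bar>g x\<bar> / B))) powr p"
      using p by (intro powr_mono2) auto
    also have "\<dots> = (A + B) powr p * (l * (\<bar>f x\<bar> / A) + (1 - l) * (\<bar>g x\<bar> / B)) powr p"
      by (rule powr_mult)
    also have "\<dots> \<le> ?h x"
      using powr_convex_comb[OF p l(1,2), of "\<bar>f x\<bar> / A" "\<bar>g x\<bar> / B"] A0 B0
      by (intro mult_left_mono) (auto simp: powr_divide)
    finally show ?thesis .
  qed
  have hi: "integrable M ?h" using f g by simp
  show int: "integrable M (\<lambda>x. \<bar>f x + g x\<bar> powr p)"
  proof (rule Bochner_Integration.integrable_bound[OF hi])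
    show "(\<lambda>x. \<bar>f x + g x\<bar> powr p) \<in> borel_measurable M" using f g by simp
    show "AE x in M. norm (\<bar>f x + g x\<bar> powr p) \<le> norm (?h x)"
    proof (intro always_eventually allI)
      fix x show "norm (\<bar>f x + g x\<bar> powr p) \<le> norm (?h x)"
        using order_trans[OF le abs_ge_self, of x] unfolding real_norm_def by simp
    qed
  qed
  have "(\<integral>x. \<bar>f x\<bar> powr p \<partial>M) \<le> A powr p" "(\<integral>x. \<bar>g x\<bar> powr p \<partial>M) \<le> B powr p"
    using A B p Lp_norm_nonneg[of p M f] Lp_norm_nonneg[of p M g]
    by (auto simp flip: Lp_norm_powr intro!: powr_mono2)
  then have *: "(\<integral>x. \<bar>f x\<bar> powr p \<partial>M) / A powr p \<le> 1" "(\<integral>x. \<bar>g x\<bar> powr p \<partial>M) / B powr p \<le> 1"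
    using A0 B0 by auto
  have "(\<integral>x. \<bar>f x + g x\<bar> powr p \<partial>M) \<le> (\<integral>x. ?h x \<partial>M)"
    by (rule integral_mono[OF int hi le])
  also have "\<dots> = (A + B) powr p * (l * ((\<integral>x. \<bar>f x\<bar> powr p \<partial>M) / A powr p)
      + (1 - l) * ((\<integral>x. \<bar>g x\<bar> powr p \<partial>M) / B powr p))"
    using f g by simp
  also have "\<dots> \<le> (A + B) powr p * (l * 1 + (1 - l) * 1)"
    using * l by (intro mult_left_mono add_mono) auto
  finally have "(\<integral>x. \<bar>f x + g x\<bar> powr p \<partial>M) \<le> (A + B) powr p" by simp
  then have "Lp_norm p M (\<lambda>x. f x + g x) \<le> ((A + B) powr p) powr (1 / p)"
    unfolding Lp_norm_def using p by (intro powr_mono2) (auto intro: Bochner_Integration.integral_nonneg)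
  also have "\<dots> = A + B" using p A0 B0 by (simp add: powr_powr)
  finally show "Lp_norm p M (\<lambda>x. f x + g x) \<le> A + B" .
qed

lemma Minkowski:
  assumes p: "p \<ge> 1"
    and f: "f \<in> borel_measurable M" "integrable M (\<lambda>x. \<bar>f x\<bar> powr p)"
    and g: "g \<in> borel_measurable M" "integrable M (\<lambda>x. \<bar>g x\<bar> powr p)"
  shows "integrable M (\<lambda>x. \<bar>f x + g x\<bar> powr p)"
    "Lp_norm p M (\<lambda>x. f x + g x) \<le> Lp_norm p M f + Lp_norm p M g"
proof -
  show "integrable M (\<lambda>x. \<bar>f x + g x\<bar> powr p)"
    by (rule Minkowski_aux(1)[OF p f g, of "Lp_norm p M f + 1" "Lp_norm p M g + 1"]) auto
  show "Lp_norm p M (\<lambda>x. f x + g x) \<le> Lp_norm p M f + Lp_norm p M g"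
  proof (rule field_le_epsilon)
    fix e :: real assume "e > 0"
    then have "Lp_norm p M (\<lambda>x. f x + g x) \<le> (Lp_norm p M f + e/2) + (Lp_norm p M g + e/2)"
      by (intro Minkowski_aux(2)[OF p f g]) auto
    then show "Lp_norm p M (\<lambda>x. f x + g x) \<le> Lp_norm p M f + Lp_norm p M g + e" by simp
  qed
qed

lemma Lp_norm_scale:
  assumes "p > 0"
  shows "Lp_norm p M (\<lambda>x. c * f x) = \<bar>c\<bar> * Lp_norm p M f"
  using assms
  by (simp add: Lp_norm_def abs_mult powr_mult powr_powr Bochner_Integration.integral_nonneg)

lemma Lp_norm_eq_0:
  assumes "p > 0" "integrable M (\<lambda>x. \<bar>f x\<bar> powr p)"
  shows "Lp_norm p M f = 0 \<longleftrightarrow> (AE x in M. f x = 0)"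
  using integral_nonneg_eq_0_iff_AE[OF assms(2)] assms by (simp add: Lp_norm_def)

lemma Lp_norm_cong_AE:
  assumes "f \<in> borel_measurable M" "g \<in> borel_measurable M" "AE x in M. f x = g x"
  shows "Lp_norm p M f = Lp_norm p M g"
  unfolding Lp_norm_def using assms by (subst integral_cong_AE[of _ M "\<lambda>x. \<bar>g x\<bar> powr p"]) auto

lemma L32_L32_zero: "(\<lambda>t x. 0) \<in> L32_L32 r"
  by (simp add: L32_L32_def)

lemma L32_L32_add:
  assumes "f \<in> L32_L32 r" "g \<in> L32_L32 r"
  shows "(\<lambda>t x. f t x + g t x) \<in> L32_L32 r"
    "L32_L32_norm r (\<lambda>t x. f t x + g t x) \<le> L32_L32_norm r f + L32_L32_norm r g"
proof -
  have eq: "case_prod (\<lambda>t x. f t x + g t x) = (\<lambda>z. case_prod f z + case_prod g z)" by auto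
  note f = assms(1)[unfolded L32_L32_iff] and g = assms(2)[unfolded L32_L32_iff]
  show mem: "(\<lambda>t x. f t x + g t x) \<in> L32_L32 r"
    unfolding L32_L32_iff eq using Minkowski(1)[of "3/2" "case_prod f" _ "case_prod g"] f g by auto
  show "L32_L32_norm r (\<lambda>t x. f t x + g t x) \<le> L32_L32_norm r f + L32_L32_norm r g"
    unfolding L32_L32_norm_eq[OF mem] L32_L32_norm_eq[OF assms(1)] L32_L32_norm_eq[OF assms(2)] eq
    using Minkowski(2)[of "3/2" "case_prod f" _ "case_prod g"] f g by auto
qed

lemma L32_L32_scale:
  assumes "f \<in> L32_L32 r"
  shows "(\<lambda>t x. c * f t x) \<in> L32_L32 r" "L32_L32_norm r (\<lambda>t x. c * f t x) = \<bar>c\<bar> * L32_L32_norm r f"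
proof -
  have eq: "case_prod (\<lambda>t x. c * f t x) = (\<lambda>z. c * case_prod f z)" by auto
  show mem: "(\<lambda>t x. c * f t x) \<in> L32_L32 r"
    using assms unfolding L32_L32_iff eq by (auto simp: abs_mult powr_mult)
  show "L32_L32_norm r (\<lambda>t x. c * f t x) = \<bar>c\<bar> * L32_L32_norm r f"
    unfolding L32_L32_norm_eq[OF mem] L32_L32_norm_eq[OF assms] eq by (simp add: Lp_norm_scale)
qed

definition Yprs_rel :: "(real \<Rightarrow> real ^ 3 \<Rightarrow> real) \<Rightarrow> (real \<Rightarrow> real ^ 3 \<Rightarrow> real) \<Rightarrow> bool"
  where "Yprs_rel f g \<longleftrightarrow> f \<in> L32_L32 (1/2) \<and> g \<in> L32_L32 (1/2) \<and>
    (AE z in cyl_measure (1/2). case_prod f z = case_prod g z)"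

text \<open>$Y_{\mathrm{prs}}=L^{3/2}(I;L^{3/2}(B_{1/2}))$, modulo equality almost everywhere.\<close>

quotient_type Yprs = "real \<Rightarrow> real ^ 3 \<Rightarrow> real" / partial: Yprs_rel
proof (rule part_equivpI)
  show "\<exists>f. Yprs_rel f f" using L32_L32_zero by (auto simp: Yprs_rel_def)
  show "symp Yprs_rel" by (auto simp: Yprs_rel_def symp_def)
  show "transp Yprs_rel" unfolding Yprs_rel_def transp_def by auto
qed

lemma Yprs_rel_norm:
  assumes "Yprs_rel f g" shows "L32_L32_norm (1/2) f = L32_L32_norm (1/2) g"
  using assms Lp_norm_cong_AE[of "case_prod f" "cyl_measure (1/2)" "case_prod g"]
  by (auto simp: Yprs_rel_def L32_L32_norm_eq L32_L32_iff)

instantiation Yprs :: real_normed_vector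
begin

lift_definition zero_Yprs :: Yprs is "\<lambda>t x. 0"
  by (simp add: Yprs_rel_def L32_L32_zero)

lift_definition plus_Yprs :: "Yprs \<Rightarrow> Yprs \<Rightarrow> Yprs" is "\<lambda>f g t x. f t x + g t x"
  unfolding Yprs_rel_def by (auto intro: L32_L32_add)

lift_definition scaleR_Yprs :: "real \<Rightarrow> Yprs \<Rightarrow> Yprs" is "\<lambda>c f t x. c * f t x"
  unfolding Yprs_rel_def by (auto intro: L32_L32_scale)

lift_definition norm_Yprs :: "Yprs \<Rightarrow> real" is "L32_L32_norm (1/2)"
  by (rule Yprs_rel_norm)

definition uminus_Yprs :: "Yprs \<Rightarrow> Yprs" where "uminus_Yprs f = (-1) *\<^sub>R f"
definition minus_Yprs :: "Yprs \<Rightarrow> Yprs \<Rightarrow> Yprs" where "minus_Yprs f g = f + (- g)"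
definition dist_Yprs :: "Yprs \<Rightarrow> Yprs \<Rightarrow> real" where "dist_Yprs f g = norm (f - g)"
definition sgn_Yprs :: "Yprs \<Rightarrow> Yprs" where "sgn_Yprs f = inverse (norm f) *\<^sub>R f"
definition uniformity_Yprs :: "(Yprs \<times> Yprs) filter"
  where "uniformity_Yprs = (INF e\<in>{0<..}. principal {(x, y). dist x y < e})"
definition open_Yprs :: "Yprs set \<Rightarrow> bool"
  where "open_Yprs S = (\<forall>x\<in>S. \<forall>\<^sub>F (x', y) in uniformity. x' = x \<longrightarrow> y \<in> S)"

instance
proof
  fix x y z :: Yprs and a b :: real
  show "x + y + z = x + (y + z)"
    by transfer (auto simp: Yprs_rel_def add.assoc intro!: L32_L32_add)
  show "x + y = y + x"
    by transfer (auto simp: Yprs_rel_def add.commute intro!: L32_L32_add)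
  show "0 + x = x"
    by transfer (auto simp: Yprs_rel_def)
  show "- x + x = 0" unfolding uminus_Yprs_def
    by transfer (auto simp: Yprs_rel_def intro!: L32_L32_zero L32_L32_add L32_L32_scale(1)[of _ _ "-1", simplified])
  show "x - y = x + - y" by (simp add: minus_Yprs_def)
  show "a *\<^sub>R (x + y) = a *\<^sub>R x + a *\<^sub>R y"
    by transfer (auto simp: Yprs_rel_def distrib_left intro!: L32_L32_add L32_L32_scale)
  show "(a + b) *\<^sub>R x = a *\<^sub>R x + b *\<^sub>R x"
    by transfer (auto simp: Yprs_rel_def distrib_right intro!: L32_L32_add L32_L32_scale)
  show "a *\<^sub>R b *\<^sub>R x = (a * b) *\<^sub>R x"
    by transfer (auto simp: Yprs_rel_def mult.assoc intro!: L32_L32_scale)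
  show "1 *\<^sub>R x = x" by transfer (auto simp: Yprs_rel_def)
  show "dist x y = norm (x - y)" by (simp add: dist_Yprs_def)
  show "sgn x = inverse (norm x) *\<^sub>R x" by (simp add: sgn_Yprs_def)
  show "uniformity = (INF e\<in>{0<..}. principal {(x, y). dist x (y::Yprs) < e})"
    by (rule uniformity_Yprs_def)
  show "open U = (\<forall>x\<in>U. \<forall>\<^sub>F (x', y) in uniformity. x' = x \<longrightarrow> y \<in> U)" for U :: "Yprs set"
    by (rule open_Yprs_def)
  show "norm x = 0 \<longleftrightarrow> x = 0"
  proof transfer
    fix f assume "Yprs_rel f f"
    then show "(L32_L32_norm (1/2) f = 0) = Yprs_rel f (\<lambda>t x. 0)"
      by (auto simp: Yprs_rel_def L32_L32_norm_eq L32_L32_zero Lp_norm_eq_0 L32_L32_iff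
          split_beta)
  qed
  show "norm (x + y) \<le> norm x + norm y"
    by transfer (auto simp: Yprs_rel_def intro!: L32_L32_add)
  show "norm (a *\<^sub>R x) = \<bar>a\<bar> * norm x"
    by transfer (auto simp: Yprs_rel_def L32_L32_scale)
qed

end

section \<open>Riesz transforms and the clean source tensor\<close>

text \<open>Riesz transforms on $\mathbb R^3$ as principal values; the kernel constant is
  $\Gamma(2)/\pi^2 = 1/\pi^2$. For $f\in L^p$, $1\le p<\infty$, the limit exists almost everywhere;
  on the remaining null set the value is an irrelevant constant.\<close>

definition Riesz :: "3 \<Rightarrow> (real ^ 3 \<Rightarrow> real) \<Rightarrow> real ^ 3 \<Rightarrow> real"
  where "Riesz i f x = Lim (at_right 0)
    (\<lambda>\<epsilon>. 1 / pi\<^sup>2 * (LINT y:{y. \<epsilon> < norm y}|lborel. y $ i / norm y ^ 4 * f (x - y)))"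

text \<open>\<open>U D\<close> and \<open>R D\<close> are the velocity and covariance fields carried by the package \<open>D\<close>.\<close>

definition clean_source ::
    "('d \<Rightarrow> real \<Rightarrow> real ^ 3 \<Rightarrow> real ^ 3) \<Rightarrow> ('d \<Rightarrow> real \<Rightarrow> real ^ 3 \<Rightarrow> real ^ 3 ^ 3) \<Rightarrow>
      'd \<Rightarrow> 3 \<Rightarrow> 3 \<Rightarrow> real \<Rightarrow> real ^ 3 \<Rightarrow> real"
  where "clean_source U R D i j t x = U D t x $ i * U D t x $ j + R D t x $ i $ j"

text \<open>$\mathsf R_i\mathsf R_j F_{ij}$ (summed) for a tensor on $B_1$ extended by zero to
  $\mathbb R^3$, at each time.\<close>

definition double_Riesz ::
    "(3 \<Rightarrow> 3 \<Rightarrow> real \<Rightarrow> real ^ 3 \<Rightarrow> real) \<Rightarrow> real \<Rightarrow> real ^ 3 \<Rightarrow> real"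
  where "double_Riesz F t =
    (\<lambda>x. \<Sum>i\<in>UNIV. \<Sum>j\<in>UNIV. Riesz i (Riesz j (\<lambda>y. indicator (ball 0 1) y * F i j t y)) x)"

section \<open>Intrinsic packages and distances\<close>

text \<open>The normed spaces $X_k^{(j)}$ are linear subspaces \<open>X k j\<close> of one ambient normed space, which is
  no restriction (take their direct sum). Packages vanish outside the index range, so that they
  form a linear subspace of the function space.\<close>

type_synonym 'v package = "int \<Rightarrow> nat \<Rightarrow> 'v"

definition packages :: "int set \<Rightarrow> (int \<Rightarrow> nat \<Rightarrow> 'v set) \<Rightarrow> 'v::real_normed_vector package set"
  where "packages \<Lambda> X = {D. \<forall>k j. (k \<in> \<Lambda> \<and> j \<in> {1..7} \<longrightarrow> D k j \<in> X k j) \<and>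
                              (k \<notin> \<Lambda> \<or> j \<notin> {1..7} \<longrightarrow> D k j = 0)}"

definition loc_norm :: "int set \<Rightarrow> (nat \<Rightarrow> real) \<Rightarrow> 'v::real_normed_vector package \<Rightarrow> real"
  where "loc_norm \<Lambda> a D = sqrt (\<Sum>k\<in>\<Lambda>. \<Sum>j=1..7. a j * (norm (D k j))\<^sup>2)"

definition loc_dist ::
    "int set \<Rightarrow> (nat \<Rightarrow> real) \<Rightarrow> 'v::real_normed_vector package \<Rightarrow> 'v package set \<Rightarrow> real"
  where "loc_dist \<Lambda> a D \<Gamma> = (INF \<zeta>\<in>\<Gamma>. loc_norm \<Lambda> a (D - \<zeta>))"

definition T_proj ::
    "('v package \<Rightarrow> real \<Rightarrow> real ^ 3 \<Rightarrow> real ^ 3) \<Rightarrow> ('v package \<Rightarrow> real \<Rightarrow> real ^ 3 \<Rightarrow> real ^ 3 ^ 3) \<Rightarrow>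
      (Yprs \<Rightarrow> Yprs) \<Rightarrow> 'v::real_normed_vector package \<Rightarrow> 'v package \<Rightarrow> real"
  where "T_proj U R P D \<zeta> =
    (1 + onorm P) * L32_L32_norm (1/2) (double_Riesz (clean_source U R (D - \<zeta>)))"

definition T_harm ::
    "('v package \<Rightarrow> 'h::real_normed_vector) \<Rightarrow> ('h \<Rightarrow> 'h) \<Rightarrow> ('h \<Rightarrow> Yprs) \<Rightarrow>
      'v::real_normed_vector package \<Rightarrow> 'v package \<Rightarrow> real"
  where "T_harm p_harm Q J D \<zeta> = onorm J * norm (p_harm (D - \<zeta>) - Q (p_harm (D - \<zeta>)))"

definition tail_dist ::
    "int set \<Rightarrow> (nat \<Rightarrow> real) \<Rightarrow> real \<Rightarrow> real \<Rightarrow>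
      ('v package \<Rightarrow> 'v package \<Rightarrow> real) \<Rightarrow> ('v package \<Rightarrow> 'v package \<Rightarrow> real) \<Rightarrow>
      'v::real_normed_vector package \<Rightarrow> 'v package set \<Rightarrow> real"
  where "tail_dist \<Lambda> a \<alpha>_proj \<alpha>_harm Tproj Tharm D \<Gamma> =
    (INF \<zeta>\<in>\<Gamma>. loc_norm \<Lambda> a (D - \<zeta>) + \<alpha>_proj * Tproj D \<zeta> + \<alpha>_harm * Tharm D \<zeta>)"

end

theory Submission
  imports Defs
begin

text \<open>An infimum is at most the value at any one competitor. The hypothesis supplies, for each
  package \<open>D\<close>, a single \<open>\<zeta>\<close> in \<open>\<Gamma>\<close> that is
  nearly optimal for \<open>loc_dist\<close> and at the same time controls both tails. Inserting
  this \<open>\<zeta>\<close> into the functional behind \<open>tail_dist\<close>, bounding its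
  three terms and collecting the multiples of \<open>loc_dist\<close> gives the estimate. The point
  needing care is that a real infimum lies below its members only if they are bounded below. The
  nonnegativity lemmas provide the bound 0, and \<open>tail_dist_le\<close> turns it into the
  comparison with one competitor.\<close>

lemma loc_norm_nonneg:
  assumes "\<And>j. j \<in> {1..7} \<Longrightarrow> a j \<ge> 0"
  shows "0 \<le> loc_norm \<Lambda> a D"
  unfolding loc_norm_def using assms
  by (intro real_sqrt_ge_zero sum_nonneg mult_nonneg_nonneg) auto

text \<open>Boundedness of \<open>P\<close> makes the supremum defining \<open>onorm P\<close> a
  genuine one, hence nonnegative. The other factor is a real power, nonnegative for every function,
  so no mapping property of the Riesz transforms enters.\<close>

lemma T_proj_nonneg: "bounded_linear P \<Longrightarrow> 0 \<le> T_proj U R P D \<zeta>"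
  using onorm_pos_le[of P] by (simp add: T_proj_def L32_L32_norm_def Lp_norm_nonneg)

lemma T_harm_nonneg: "bounded_linear J \<Longrightarrow> 0 \<le> T_harm p_harm Q J D \<zeta>"
  using onorm_pos_le[of J] by (simp add: T_harm_def)

text \<open>All three summands are nonnegative at every competitor, so 0 bounds the family from
  below and \<open>cINF_lower\<close> applies at \<open>\<zeta>\<close>.\<close>

lemma tail_dist_le:
  assumes "\<zeta> \<in> \<Gamma>"
    and "\<And>j. j \<in> {1..7} \<Longrightarrow> a j \<ge> 0" "\<alpha>_proj \<ge> 0" "\<alpha>_harm \<ge> 0"
    and "\<And>\<xi>. 0 \<le> Tproj D \<xi>" "\<And>\<xi>. 0 \<le> Tharm D \<xi>"
  shows "tail_dist \<Lambda> a \<alpha>_proj \<alpha>_harm Tproj Tharm D \<Gamma>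
    \<le> loc_norm \<Lambda> a (D - \<zeta>) + \<alpha>_proj * Tproj D \<zeta> + \<alpha>_harm * Tharm D \<zeta>"
  unfolding tail_dist_def using assms
  by (intro cINF_lower bdd_belowI2[where m = 0] add_nonneg_nonneg mult_nonneg_nonneg
      loc_norm_nonneg) auto

theorem theorem9p145:
  fixes \<Lambda> :: "int set" and X :: "int \<Rightarrow> nat \<Rightarrow> 'v::real_normed_vector set"
    and a :: "nat \<Rightarrow> real" and \<Gamma> :: "'v package set"
    and U :: "'v package \<Rightarrow> real \<Rightarrow> real ^ 3 \<Rightarrow> real ^ 3"
    and R :: "'v package \<Rightarrow> real \<Rightarrow> real ^ 3 \<Rightarrow> real ^ 3 ^ 3"
    and p_harm :: "'v package \<Rightarrow> 'h::real_normed_vector"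
    and P :: "Yprs \<Rightarrow> Yprs" and Q :: "'h \<Rightarrow> 'h" and J :: "'h \<Rightarrow> Yprs"
    and \<alpha>_proj \<alpha>_harm \<delta>_int C_proj C_harm \<Delta>_proj \<Delta>_harm :: real
  assumes index_set: "\<exists>m n. \<Lambda> = {m..n}"
    and spaces: "\<And>k j. k \<in> \<Lambda> \<Longrightarrow> j \<in> {1..7} \<Longrightarrow> subspace (X k j)"
    and weights: "\<And>j. j \<in> {1..7} \<Longrightarrow> a j > 0"
    and subspace_\<Gamma>: "subspace \<Gamma>" "\<Gamma> \<subseteq> packages \<Lambda> X"
    and source: "\<And>D i j. D \<in> packages \<Lambda> X \<Longrightarrow> clean_source U R D i j \<in> L32_L32 1"
    and P: "bounded_linear P" "P \<circ> P = P"
    and Q: "bounded_linear Q" "Q \<circ> Q = Q" "\<exists>B. finite B \<and> range Q = span B"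
    and J: "bounded_linear J"
    and alphas: "\<alpha>_proj > 0" "\<alpha>_harm > 0"
    and constants: "\<delta>_int \<ge> 0" "\<Delta>_proj \<ge> 0" "\<Delta>_harm \<ge> 0"
    and approx: "\<And>D. D \<in> packages \<Lambda> X \<Longrightarrow> \<exists>\<zeta>\<in>\<Gamma>.
        loc_norm \<Lambda> a (D - \<zeta>) \<le> loc_dist \<Lambda> a D \<Gamma> + \<delta>_int \<and>
        T_proj U R P D \<zeta> \<le> C_proj * loc_dist \<Lambda> a D \<Gamma> + \<Delta>_proj \<and>
        T_harm p_harm Q J D \<zeta> \<le> C_harm * loc_dist \<Lambda> a D \<Gamma> + \<Delta>_harm"
  shows "\<forall>D\<in>packages \<Lambda> X.
      tail_dist \<Lambda> a \<alpha>_proj \<alpha>_harm (T_proj U R P) (T_harm p_harm Q J) D \<Gamma>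
        \<le> (1 + \<alpha>_proj * C_proj + \<alpha>_harm * C_harm) * loc_dist \<Lambda> a D \<Gamma>
           + \<delta>_int + \<alpha>_proj * \<Delta>_proj + \<alpha>_harm * \<Delta>_harm"
proof
  fix D assume "D \<in> packages \<Lambda> X"
  then obtain \<zeta> where \<zeta>: "\<zeta> \<in> \<Gamma>"
    and loc: "loc_norm \<Lambda> a (D - \<zeta>) \<le> loc_dist \<Lambda> a D \<Gamma> + \<delta>_int"
    and proj: "T_proj U R P D \<zeta> \<le> C_proj * loc_dist \<Lambda> a D \<Gamma> + \<Delta>_proj"
    and harm: "T_harm p_harm Q J D \<zeta> \<le> C_harm * loc_dist \<Lambda> a D \<Gamma> + \<Delta>_harm"
    using approx by blast
  have "tail_dist \<Lambda> a \<alpha>_proj \<alpha>_harm (T_proj U R P) (T_harm p_harm Q J) D \<Gamma>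
      \<le> loc_norm \<Lambda> a (D - \<zeta>) + \<alpha>_proj * T_proj U R P D \<zeta> + \<alpha>_harm * T_harm p_harm Q J D \<zeta>"
    using \<zeta> alphas weights P(1) J
    by (intro tail_dist_le) (auto intro: T_proj_nonneg T_harm_nonneg less_imp_le)
  \<comment> \<open>The three bounds hold at the same \<open>\<zeta>\<close>, so they can be added
    termwise; multiplying the tail bounds by the positive weights \<open>\<alpha>_proj\<close> and
    \<open>\<alpha>_harm\<close> preserves their direction.\<close>
  also have "\<dots> \<le> (loc_dist \<Lambda> a D \<Gamma> + \<delta>_int) + \<alpha>_proj * (C_proj * loc_dist \<Lambda> a D \<Gamma> + \<Delta>_proj)
      + \<alpha>_harm * (C_harm * loc_dist \<Lambda> a D \<Gamma> + \<Delta>_harm)"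
    using loc proj harm alphas by (intro add_mono mult_left_mono) auto
  finally show "tail_dist \<Lambda> a \<alpha>_proj \<alpha>_harm (T_proj U R P) (T_harm p_harm Q J) D \<Gamma>
      \<le> (1 + \<alpha>_proj * C_proj + \<alpha>_harm * C_harm) * loc_dist \<Lambda> a D \<Gamma>
         + \<delta>_int + \<alpha>_proj * \<Delta>_proj + \<alpha>_harm * \<Delta>_harm"
    by (simp add: algebra_simps)
qed

end
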